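(* Let $m_1,m_2\in\mathbb{N}$, $m=m_1+m_2$, and consider the self-adjoint Dirac system $$y'(x,z)=\mathrm{i}\big(zj+jV(x)\big)y(x,z),\quad x\ge 0,\qquad j=\begin{bmatrix} I_{m_1}&0\\0&-I_{m_2}\end{bmatrix},\quad V=\begin{bmatrix}0&v\\ v^*&0\end{bmatrix},$$ where $v$ is an $m_1\times m_2$ matrix function on $\mathbb{R}_+=[0,\infty)$ and the entries of $V$ belong to $L^1(\mathbb{R}_+)$. Then the Weyl function of this system may be continuously extended from $\mathbb{C}_+$ to the boundary $\mathbb{R}$.
   Context: $\mathbb{C}_+$ is the open upper half-plane; $y'=\frac{d}{dx}y$; $I_k$ is the $k\times k$ identity matrix. Weyl function: let $u(x,z)$ be the fundamental solution of the Dirac system with $u(0,z)=I_m$. The Weyl function of the self-adjoint Dirac system on $[0,\infty)$ (with locally summable $V$) is the $m_2\times m_1$ matrix function $\varphi$ on $\mathbb{C}_+$ such that $$\int_0^\infty\begin{bmatrix}I_{m_1}&\varphi(z)^*\end{bmatrix}u(x,z)^*u(x,z)\begin{bmatrix}I_{m_1}\\ \varphi(z)\end{bmatrix}dx<\infty,\qquad z\in\mathbb{C}_+.$$ It is known that in the self-adjoint case such $\varphi$ exists, is unique, holomorphic and contractive ($\varphi(z)^*\varphi(z)\le I_{m_1}$) on $\mathbb{C}_+$. *)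

theory Defs
  imports "HOL-Analysis.Analysis"
begin

definition block ::
  "complex^'a^'c \<Rightarrow> complex^'b^'c \<Rightarrow> complex^'a^'d \<Rightarrow> complex^'b^'d \<Rightarrow> complex^('a + 'b)^('c + 'd)"
  where "block A B C D = (\<chi> r s. case r of
      Inl i \<Rightarrow> (case s of Inl k \<Rightarrow> A $ i $ k | Inr k \<Rightarrow> B $ i $ k)
    | Inr i \<Rightarrow> (case s of Inl k \<Rightarrow> C $ i $ k | Inr k \<Rightarrow> D $ i $ k))"

definition stack :: "complex^'a^'c \<Rightarrow> complex^'a^'d \<Rightarrow> complex^'a^('c + 'd)"
  where "stack A C = (\<chi> r s. case r of Inl i \<Rightarrow> A $ i $ s | Inr i \<Rightarrow> C $ i $ s)"

definition ctranspose :: "complex^'n^'m \<Rightarrow> complex^'m^'n"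
  where "ctranspose A = map_matrix cnj (transpose A)"

definition cscale :: "complex \<Rightarrow> complex^'n^'m \<Rightarrow> complex^'n^'m"
  where "cscale c A = map_matrix (\<lambda>a. c * a) A"

definition dirac_j :: "complex^('m1::finite + 'm2::finite)^('m1 + 'm2)"
  where "dirac_j = block (mat 1) 0 0 (- mat 1)"

definition dirac_V :: "(real \<Rightarrow> complex^'m2^'m1) \<Rightarrow> real \<Rightarrow> complex^('m1 + 'm2)^('m1 + 'm2)"
  where "dirac_V v x = block 0 (v x) (ctranspose (v x)) 0"

(* The usual epsilon-delta definition. A division of t is a finite family of closed intervals
   with pairwise disjoint interiors and union t, so d ranges over all finite families of
   non-overlapping closed subintervals [Inf k, Sup k] of [a,b]. *)
definition absolutely_continuous_on_interval ::
  "real \<Rightarrow> real \<Rightarrow> (real \<Rightarrow> 'a::real_normed_vector) \<Rightarrow> bool"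
  where "absolutely_continuous_on_interval a b f \<longleftrightarrow>
    (\<forall>\<epsilon>>0. \<exists>\<delta>>0. \<forall>d t. d division_of t \<and> t \<subseteq> {a..b} \<and> (\<Sum>k\<in>d. Sup k - Inf k) < \<delta>
      \<longrightarrow> (\<Sum>k\<in>d. norm (f (Sup k) - f (Inf k))) < \<epsilon>)"

(* Since v is only a (locally) summable function, solutions are understood in the sense of
   Caratheodory: locally absolutely continuous on [0,infinity), with the equation
   holding almost everywhere. *)
definition dirac_solution ::
  "(real \<Rightarrow> complex^'m2^'m1) \<Rightarrow> complex \<Rightarrow> (real \<Rightarrow> complex^'k^('m1 + 'm2)) \<Rightarrow> bool"
  where "dirac_solution v z y \<longleftrightarrow>
    (\<forall>b\<ge>0. absolutely_continuous_on_interval 0 b y) \<and>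
    (AE x in lebesgue. 0 \<le> x \<longrightarrow>
      (y has_vector_derivative cscale \<i> (cscale z dirac_j + dirac_j ** dirac_V v x) ** y x)
        (at x within {0..}))"

definition fundamental_solution ::
  "(real \<Rightarrow> complex^'m2^'m1) \<Rightarrow> (real \<Rightarrow> complex \<Rightarrow> complex^('m1 + 'm2)^('m1 + 'm2)) \<Rightarrow> bool"
  where "fundamental_solution v u \<longleftrightarrow>
    (\<forall>z. u 0 z = mat 1 \<and> dirac_solution v z (\<lambda>x. u x z))"

(* Only the values of \<phi> on the open upper half-plane matter. The integrand is a nonnegative
   matrix, so finiteness of its integral means (entrywise) Lebesgue integrability. *)
definition is_weyl_function ::
  "(real \<Rightarrow> complex^'m2^'m1) \<Rightarrow> (complex \<Rightarrow> complex^'m1^'m2) \<Rightarrow> bool"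
  where "is_weyl_function v \<phi> \<longleftrightarrow> (\<exists>u. fundamental_solution v u \<and>
    (\<forall>z. 0 < Im z \<longrightarrow>
      (\<lambda>x. ctranspose (stack (mat 1) (\<phi> z)) ** ctranspose (u x z) ** u x z ** stack (mat 1) (\<phi> z))
        absolutely_integrable_on {0..}))"

end

(* Let y = u [I; phi] h be a Weyl solution with parts a and b, and put A = exp(-izx) a and
   B = exp(-izx) b, so that A' = i v B and B' = -2iz B - i v* A with A(0) = h, B(0) = phi(z) h.
   Square integrability of y and monotonicity of |a|^2 - |b|^2 give |B| <= |A|, so Gronwall bounds
   A and B by a constant C depending only on the L^1 norm of v; hence also |B(l)| is at most C times
   the integral of |v| over [l, infinity), uniformly in z.  For two parameters z, w and the same h
   the differences P = A_z - A_w and Q = B_z - B_w satisfy P(0) = 0, and the potential cancels in the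
   derivative of |P|^2 - |Q|^2, which is thus at most 8 C^2 |z - w|.  Therefore
     |(phi(z) - phi(w)) h|^2 = |Q(0)|^2 <= |Q(l)|^2 + 8 C^2 |z - w| l,
   and choosing first l and then |z - w| shows that phi is uniformly continuous on the open upper
   half-plane, hence extends continuously to its closure. *)
theory Submission
  imports Defs
begin

section \<open>The fundamental theorem of calculus for absolutely continuous functions\<close>

text \<open>Absolute continuity speaks of untagged divisions, gauge integrals of tagged ones.
  Forgetting the tags merges no terms: an interval with two distinct tags would have empty interior
  and yet contain two points.\<close>

lemma sum_snd_tagged_partial_division_real:
  fixes p :: "(real \<times> real set) set"
  assumes p: "p tagged_partial_division_of S"
    and d: "\<And>c. d {c} = 0"
  shows "(\<Sum>K\<in>snd ` p. d K) = (\<Sum>(x, K)\<in>p. d K)"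
proof -
  note pD = tagged_partial_division_ofD[OF p]
  have "d K = 0" if xy: "(x, K) \<in> p" "(y, K) \<in> p" "x \<noteq> y" for x y K
  proof -
    have "interior K = {}"
      using pD(5)[OF xy(1,2)] xy(3) by auto
    moreover obtain a b where "K = {a..b}"
      using pD(4)[OF xy(1)] by auto
    moreover have "x \<in> K" "y \<in> K"
      using pD(2) xy by auto
    ultimately show ?thesis
      using xy(3) by auto
  qed
  then have "(\<Sum>K\<in>snd ` p. d K) = (\<Sum>n\<in>p. (d \<circ> snd) n)"
    by (intro sum.reindex_nontrivial pD(1)) (auto, blast)
  then show ?thesis
    by (simp add: case_prod_unfold)
qed

lemma negligible_cover_open_small:
  fixes N :: "real set"
  assumes "negligible N" "\<delta> > 0"
  obtains U where "open U" "N \<subseteq> U" "U \<in> lmeasurable" "measure lebesgue U < \<delta>"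
proof -
  have N: "N \<in> null_sets lebesgue"
    using assms(1) negligible_iff_null_sets by blast
  obtain U where U: "open U" "N \<subseteq> U" "U - N \<in> lmeasurable" "emeasure lebesgue (U - N) < ennreal \<delta>"
    using sets_lebesgue_outer_open[OF _ assms(2), of N] N by blast
  have "U = (U - N) \<union> N"
    using U by auto
  then have "U \<in> lmeasurable" "measure lebesgue U = measure lebesgue (U - N)"
    using U N measure_Un_null_set[of "U - N" lebesgue N]
    by (metis fmeasurable.Un fmeasurableD2 fmeasurable_def fmeasurableI_null_sets,
        metis fmeasurableD)
  moreover have "measure lebesgue (U - N) < \<delta>"
    using U assms(2) by (simp add: measure_def) (metis enn2real_less_iff fmeasurable_def less_top order_less_trans ennreal_less_top)
  ultimately show ?thesis
    using U that by auto
qed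

text \<open>Intervals tagged in \<open>N\<close> can be forced into an open cover of
  \<open>N\<close> whose measure is below the \<open>\<delta>\<close> of absolute continuity. As
  they do not overlap, their total length is then below \<open>\<delta>\<close> too.\<close>

lemma AC_null_set_variation_small:
  fixes f :: "real \<Rightarrow> 'a::real_normed_vector"
  assumes ac: "absolutely_continuous_on_interval a b f" and N: "negligible N" and e: "e > 0"
  shows "\<exists>\<gamma>. gauge \<gamma> \<and>
    (\<forall>p. p tagged_partial_division_of {a..b} \<and> \<gamma> fine p \<and> fst ` p \<subseteq> N
      \<longrightarrow> (\<Sum>(x, K)\<in>p. norm (f (Sup K) - f (Inf K))) < e)"
proof -
  obtain \<delta> where \<delta>: "\<delta> > 0" and ac': "\<And>d t. d division_of t \<Longrightarrow> t \<subseteq> {a..b} \<Longrightarrow>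
      (\<Sum>k\<in>d. Sup k - Inf k) < \<delta> \<Longrightarrow> (\<Sum>k\<in>d. norm (f (Sup k) - f (Inf k))) < e"
    using ac e unfolding absolutely_continuous_on_interval_def by metis
  obtain U where U: "open U" "N \<subseteq> U" "U \<in> lmeasurable" "measure lebesgue U < \<delta>"
    using negligible_cover_open_small[OF N \<delta>] .
  \<comment> \<open>Only tags in \<open>N\<close> occur here, so the gauge is left unrestricted
    elsewhere.\<close>
  define \<gamma> where "\<gamma> x = (if x \<in> N then U else UNIV)" for x
  show ?thesis
  proof (intro exI[of _ \<gamma>] conjI allI impI; (elim conjE)?)
    show "gauge \<gamma>"
      using U by (auto simp: gauge_def \<gamma>_def)
    fix p assume p: "p tagged_partial_division_of {a..b}" and fine: "\<gamma> fine p" and pN: "fst ` p \<subseteq> N"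
    note pD = tagged_partial_division_ofD[OF p]
    have div: "snd ` p division_of \<Union>(snd ` p)"
      using division_of_tagged_division[OF tagged_partial_division_of_Union_self[OF p]] .
    have sub: "\<Union>(snd ` p) \<subseteq> {a..b}" "\<Union>(snd ` p) \<subseteq> U"
      using pD(3) fine pN by (force simp: fine_def \<gamma>_def)+
    have "(\<Sum>k\<in>snd ` p. Sup k - Inf k) = (\<Sum>k\<in>snd ` p. measure lebesgue k)"
    proof (rule sum.cong)
      fix k assume k: "k \<in> snd ` p"
      obtain c d where "k = cbox c d" "k \<noteq> {}"
        using division_ofD(3,4)[OF div k] by auto
      then show "Sup k - Inf k = measure lebesgue k"
        by auto
    qed auto
    also have "\<dots> = measure lebesgue (\<Union>(snd ` p))"
      by (rule content_division[OF div])
    also have "\<dots> \<le> measure lebesgue U"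
      using sub U lmeasurable_division[OF div] by (intro measure_mono_fmeasurable) auto
    finally have "(\<Sum>k\<in>snd ` p. norm (f (Sup k) - f (Inf k))) < e"
      using U(4) by (intro ac'[OF div sub(1)]) auto
    then show "(\<Sum>(x, K)\<in>p. norm (f (Sup K) - f (Inf K))) < e"
      by (subst (asm) sum_snd_tagged_partial_division_real[OF p]) auto
  qed
qed

text \<open>Tags outside N are handled by differentiability, tags in N by absolute continuity on a
  small open cover of N.\<close>
theorem FTC_absolutely_continuous:
  fixes f :: "real \<Rightarrow> 'a::banach"
  assumes "a \<le> b" and ac: "absolutely_continuous_on_interval a b f" and N: "negligible N"
    and vecd: "\<And>x. x \<in> {a..b} - N \<Longrightarrow> (f has_vector_derivative g x) (at x within {a..b})"
  shows "(g has_integral (f b - f a)) {a..b}"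
proof -
  \<comment> \<open>Terms of a Riemann sum for \<open>g'\<close> vanish at tags in \<open>N\<close>,
    so there only the variation of \<open>f\<close> has to be small. The spike at the end of the
    proof restores \<open>g\<close>.\<close>
  define g' where "g' x = (if x \<in> N then 0 else g x)" for x
  have "(g' has_integral (f b - f a)) (cbox a b)"
    unfolding has_integral
  proof safe
    fix e :: real
    assume e: "e > 0"
    \<comment> \<open>Half of \<open>e\<close> is spread over the length of the interval; the added
      1 covers \<open>a = b\<close>.\<close>
    define \<eta> where "\<eta> = e / (2 * (b - a + 1))"
    have \<eta>: "\<eta> > 0" "\<eta> * (b - a) < e / 2"
      using e \<open>a \<le> b\<close> by (auto simp: \<eta>_def field_simps)
    \<comment> \<open>The radius is given at every \<open>x\<close>, with the default 1 outside the
      relevant set, so that choice yields a total function for the gauge.\<close>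
    have "\<exists>d>0. x \<in> {a..b} - N \<longrightarrow>
         (\<forall>y\<in>{a..b}. norm (y-x) < d \<longrightarrow> norm (f y - f x - (y-x) *\<^sub>R g x) \<le> \<eta> * norm (y-x))" for x
    proof (cases "x \<in> {a..b} - N")
      case True
      then show ?thesis
        using vecd[OF True, unfolded has_vector_derivative_def has_derivative_within_alt] \<eta>(1) by blast
    next
      case False
      then show ?thesis
        by (intro exI[of _ 1]) auto
    qed
    then obtain d where d: "\<And>x. 0 < d x"
                 "\<And>x y. \<lbrakk>x \<in> {a..b} - N; y \<in> {a..b}; norm (y-x) < d x\<rbrakk>
                        \<Longrightarrow> norm (f y - f x - (y-x) *\<^sub>R g x) \<le> \<eta> * norm (y-x)"
      by metis
    obtain \<gamma> where \<gamma>: "gauge \<gamma>"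
      "\<forall>p. p tagged_partial_division_of {a..b} \<and> \<gamma> fine p \<and> fst ` p \<subseteq> N
      \<longrightarrow> (\<Sum>(x, K)\<in>p. norm (f (Sup K) - f (Inf K))) < e / 2"
      using AC_null_set_variation_small[OF ac N half_gt_zero[OF e]] by (elim exE conjE)
    show "\<exists>\<gamma>. gauge \<gamma> \<and> (\<forall>p. p tagged_division_of (cbox a b) \<and> \<gamma> fine p \<longrightarrow>
          norm ((\<Sum>(x, k)\<in>p. measure lborel k *\<^sub>R g' x) - (f b - f a)) < e)"
    proof (rule exI[of _ "\<lambda>x. \<gamma> x \<inter> ball x (d x)"], intro conjI allI impI; (elim conjE)?)
      show "gauge (\<lambda>x. \<gamma> x \<inter> ball x (d x))"
        by (rule gauge_Int[OF \<gamma>(1)]) (simp add: gauge_def d(1))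
    next
      fix p
      assume ptag: "p tagged_division_of cbox a b" and "(\<lambda>x. \<gamma> x \<inter> ball x (d x)) fine p"
      then have fine: "\<gamma> fine p" "(\<lambda>x. ball x (d x)) fine p"
        by (auto simp: fine_Int)
      note pD = tagged_division_ofD[OF ptag]
      define q where "q = {n \<in> p. fst n \<in> N}"
      have q: "q \<subseteq> p" "finite q"
        using pD(1) by (auto simp: q_def)
      \<comment> \<open>The error of one tagged interval. The increments of \<open>f\<close>
        telescope to \<open>f b - f a\<close>, so these errors sum to the error of the whole Riemann
        sum.\<close>
      define D where "D n = (case n of (x, K) \<Rightarrow> measure lborel K *\<^sub>R g' x - (f (Sup K) - f (Inf K)))" for n
      have ba: "b - a = (\<Sum>(x,K)\<in>p. Sup K - Inf K)" "f b - f a = (\<Sum>(x,K)\<in>p. f(Sup K) - f(Inf K))"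
        using additive_tagged_division_1[where f= "\<lambda>x. x"] additive_tagged_division_1[where f= f]
            \<open>a \<le> b\<close> ptag by auto
      have "(\<Sum>n\<in>q. norm (D n)) = (\<Sum>(x, K)\<in>q. norm (f (Sup K) - f (Inf K)))"
        by (rule sum.cong) (auto simp: D_def q_def g'_def norm_minus_commute)
      also have "\<dots> < e / 2"
      proof (rule \<gamma>(2)[rule_format], intro conjI)
        show "q tagged_partial_division_of {a..b}"
          using tagged_partial_division_subset[of p "{a..b}" q] ptag q
          by (auto simp: tagged_division_of_def)
        show "\<gamma> fine q"
          using fine q fine_subset by blast
      qed (auto simp: q_def)
      finally have on_N: "(\<Sum>n\<in>q. norm (D n)) < e / 2" .
      have "norm (D (x, K)) \<le> \<eta> * (Sup K - Inf K)" if "(x, K) \<in> p - q" for x K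
      proof -
        have "(x, K) \<in> p" "x \<notin> N"
          using that by (auto simp: q_def)
        then have xK: "(x, K) \<in> p" "x \<in> K" "K \<subseteq> {a..b}" "x \<notin> N" "K \<subseteq> ball x (d x)"
          using pD(2)[of x K] pD(3)[of x K] fine(2) by (simp_all add: fine_def) blast
        obtain u v where uv: "K = {u..v}" "u \<le> x" "x \<le> v"
          using pD(4)[OF xK(1)] xK(2) by auto
        then have "u \<in> K" "v \<in> K"
          by auto
        then have "u \<in> {a..b}" "v \<in> {a..b}" "norm (u - x) < d x" "norm (v - x) < d x" "x \<in> {a..b} - N"
          using xK by (auto simp: dist_norm norm_minus_commute subset_eq)
        then have "norm (f u - f x - (u-x) *\<^sub>R g x) \<le> \<eta> * norm (u-x)"
          "norm (f v - f x - (v-x) *\<^sub>R g x) \<le> \<eta> * norm (v-x)"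
          using d(2)[of x u] d(2)[of x v] by blast+
        \<comment> \<open>Straddle argument: the tag lies between the endpoints, so the two
          distances to it add up to the length of the interval.\<close>
        then have "norm ((f u - f x - (u-x) *\<^sub>R g x) - (f v - f x - (v-x) *\<^sub>R g x)) \<le> \<eta> * norm (u-x) + \<eta> * norm (v-x)"
          by (smt (verit) norm_triangle_ineq4)
        also have "\<dots> = \<eta> * (v - u)"
          using uv by (simp add: algebra_simps)
        also have "(f u - f x - (u-x) *\<^sub>R g x) - (f v - f x - (v-x) *\<^sub>R g x) = D (x, K)"
          using uv xK by (auto simp: D_def g'_def algebra_simps)
        finally show ?thesis
          using uv by auto
      qed
      then have "(\<Sum>n\<in>p - q. norm (D n)) \<le> (\<Sum>n\<in>p - q. \<eta> * (case n of (x, K) \<Rightarrow> Sup K - Inf K))"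
        by (intro sum_mono) auto
      also have "\<dots> \<le> (\<Sum>n\<in>p. \<eta> * (case n of (x, K) \<Rightarrow> Sup K - Inf K))"
      proof (rule sum_mono2)
        fix n assume "n \<in> p - (p - q)"
        then obtain x K where xK: "n = (x, K)" "(x, K) \<in> p"
          by (cases n) auto
        obtain u v where "K = {u..v}" "u \<le> v"
          using pD(2,4)[OF xK(2)] by auto
        then show "0 \<le> \<eta> * (case n of (x, K) \<Rightarrow> Sup K - Inf K)"
          using \<eta> xK by auto
      qed (use pD(1) in auto)
      also have "\<dots> = \<eta> * (b - a)"
        by (simp add: ba sum_distrib_left)
      finally have off_N: "(\<Sum>n\<in>p - q. norm (D n)) < e / 2"
        using \<eta>(2) by linarith
      have "(\<Sum>(x, k)\<in>p. measure lborel k *\<^sub>R g' x) - (f b - f a) = (\<Sum>n\<in>p. D n)"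
        by (simp add: ba sum_subtractf D_def case_prod_unfold)
      also have "norm \<dots> \<le> (\<Sum>n\<in>p. norm (D n))"
        by (rule norm_sum)
      also have "\<dots> = (\<Sum>n\<in>p - q. norm (D n)) + (\<Sum>n\<in>q. norm (D n))"
        using q pD(1) by (simp add: sum.subset_diff)
      finally show "norm ((\<Sum>(x, k)\<in>p. measure lborel k *\<^sub>R g' x) - (f b - f a)) < e"
        using on_N off_N by linarith
    qed
  qed
  then show ?thesis
    by (intro has_integral_spike[OF N, of "{a..b}" g g']) (auto simp: g'_def)
qed

section \<open>Absolutely continuous functions with an almost everywhere derivative\<close>

lemma AC_subinterval:
  assumes "absolutely_continuous_on_interval a b f" "{c..d} \<subseteq> {a..b}"
  shows "absolutely_continuous_on_interval c d f"
  using assms unfolding absolutely_continuous_on_interval_def by (meson order_trans)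

text \<open>Common source of the closure properties below: linear images, differences, products and,
  with the identity as comparison function, Lipschitz functions. The bound is asked for on
  \<open>{a..b}\<close> only, so \<open>C\<close> may depend on local bounds.\<close>

lemma AC_dominated:
  assumes "absolutely_continuous_on_interval a b f" "absolutely_continuous_on_interval a b g"
    and le: "\<And>x y. x \<in> {a..b} \<Longrightarrow> y \<in> {a..b} \<Longrightarrow>
      norm (h y - h x) \<le> C * (norm (f y - f x) + norm (g y - g x))"
  shows "absolutely_continuous_on_interval a b h"
  unfolding absolutely_continuous_on_interval_def
proof (intro allI impI)
  fix e :: real
  assume "e > 0"
  \<comment> \<open>The 2 accounts for the two comparison sums; \<open>C\<close> may have either
    sign or be 0, whence the absolute value and the added 1.\<close>
  define \<eta> where "\<eta> = e / (2 * (\<bar>C\<bar> + 1))"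
  have \<eta>: "\<eta> > 0" "\<bar>C\<bar> * (2 * \<eta>) < e"
    using \<open>e > 0\<close> by (auto simp: \<eta>_def field_simps)
  obtain \<delta>1 where 1: "\<delta>1 > 0" "\<And>d t. d division_of t \<Longrightarrow> t \<subseteq> {a..b} \<Longrightarrow>
      (\<Sum>k\<in>d. Sup k - Inf k) < \<delta>1 \<Longrightarrow> (\<Sum>k\<in>d. norm (f (Sup k) - f (Inf k))) < \<eta>"
    using assms(1) \<eta>(1) unfolding absolutely_continuous_on_interval_def by metis
  obtain \<delta>2 where 2: "\<delta>2 > 0" "\<And>d t. d division_of t \<Longrightarrow> t \<subseteq> {a..b} \<Longrightarrow>
      (\<Sum>k\<in>d. Sup k - Inf k) < \<delta>2 \<Longrightarrow> (\<Sum>k\<in>d. norm (g (Sup k) - g (Inf k))) < \<eta>"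
    using assms(2) \<eta>(1) unfolding absolutely_continuous_on_interval_def by metis
  show "\<exists>\<delta>>0. \<forall>d t. d division_of t \<and> t \<subseteq> {a..b} \<and> (\<Sum>k\<in>d. Sup k - Inf k) < \<delta>
      \<longrightarrow> (\<Sum>k\<in>d. norm (h (Sup k) - h (Inf k))) < e"
  proof (intro exI[of _ "min \<delta>1 \<delta>2"] conjI allI impI; (elim conjE)?)
    fix d :: "real set set" and t
    assume d: "d division_of t" and t: "t \<subseteq> {a..b}" and small: "(\<Sum>k\<in>d. Sup k - Inf k) < min \<delta>1 \<delta>2"
    have "(\<Sum>k\<in>d. norm (h (Sup k) - h (Inf k)))
      \<le> (\<Sum>k\<in>d. \<bar>C\<bar> * (norm (f (Sup k) - f (Inf k)) + norm (g (Sup k) - g (Inf k))))"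
    proof (rule sum_mono)
      fix k assume k: "k \<in> d"
      obtain u v where "k = cbox u v" "k \<noteq> {}" "k \<subseteq> {a..b}"
        using division_ofD(2,3,4)[OF d k] t by blast
      then have "Inf k \<in> {a..b}" "Sup k \<in> {a..b}"
        by auto
      then have "norm (h (Sup k) - h (Inf k)) \<le> C * (norm (f (Sup k) - f (Inf k)) + norm (g (Sup k) - g (Inf k)))"
        by (rule le)
      also have "\<dots> \<le> \<bar>C\<bar> * (norm (f (Sup k) - f (Inf k)) + norm (g (Sup k) - g (Inf k)))"
        by (intro mult_right_mono) auto
      finally show "norm (h (Sup k) - h (Inf k)) \<le> \<dots>" .
    qed
    also have "\<dots> = \<bar>C\<bar> * ((\<Sum>k\<in>d. norm (f (Sup k) - f (Inf k))) + (\<Sum>k\<in>d. norm (g (Sup k) - g (Inf k))))"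
      by (simp add: sum_distrib_left[symmetric] sum.distrib)
    also have "\<dots> \<le> \<bar>C\<bar> * (2 * \<eta>)"
      using 1(2)[OF d t] 2(2)[OF d t] small by (intro mult_left_mono) auto
    finally show "(\<Sum>k\<in>d. norm (h (Sup k) - h (Inf k))) < e"
      using \<eta>(2) by linarith
  qed (use 1 2 in auto)
qed

lemma AC_ident: "absolutely_continuous_on_interval a b (\<lambda>x. x)"
proof -
  have "(\<Sum>k\<in>d. norm (Sup k - Inf k)) = (\<Sum>k\<in>d. Sup k - Inf k)"
    if div: "d division_of t" for d and t :: "real set"
  proof (rule sum.cong)
    fix k assume k: "k \<in> d"
    obtain u v where "k = cbox u v" "k \<noteq> {}"
      using division_ofD(3,4)[OF div k] by blast
    then show "norm (Sup k - Inf k) = Sup k - Inf k"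
      by auto
  qed auto
  then show ?thesis
    unfolding absolutely_continuous_on_interval_def by (metis (no_types, lifting))
qed

lemma AC_imp_continuous_on:
  fixes f :: "real \<Rightarrow> 'a::real_normed_vector"
  assumes "absolutely_continuous_on_interval a b f"
  shows "continuous_on {a..b} f"
  unfolding continuous_on_iff
proof (intro ballI allI impI)
  fix x e :: real
  assume x: "x \<in> {a..b}" and "e > 0"
  then obtain \<delta> where \<delta>: "\<delta> > 0" "\<And>d t. d division_of t \<Longrightarrow> t \<subseteq> {a..b} \<Longrightarrow>
      (\<Sum>k\<in>d. Sup k - Inf k) < \<delta> \<Longrightarrow> (\<Sum>k\<in>d. norm (f (Sup k) - f (Inf k))) < e"
    using assms unfolding absolutely_continuous_on_interval_def by metis
  have "dist (f y) (f x) < e" if y: "y \<in> {a..b}" "dist y x < \<delta>" for y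
  proof -
    \<comment> \<open>The one-element division spanned by the two points; \<open>min\<close> and
      \<open>max\<close> treat both orders at once.\<close>
    have div: "{{min x y..max x y}} division_of {min x y..max x y}"
      using division_of_self[of "min x y" "max x y"] by simp
    have "(\<Sum>k\<in>{{min x y..max x y}}. norm (f (Sup k) - f (Inf k))) < e"
      using x y by (intro \<delta>(2)[OF div]) (auto simp: dist_real_def max_def min_def split: if_splits)
    then show ?thesis
      by (cases "x \<le> y") (auto simp: dist_norm max_def min_def norm_minus_commute)
  qed
  then show "\<exists>d>0. \<forall>y\<in>{a..b}. dist y x < d \<longrightarrow> dist (f y) (f x) < e"
    using \<delta>(1) by blast
qed

text \<open>Derivative in the sense of Caratheodory, in the same form as in
  \<open>dirac_solution\<close>; changing \<open>g\<close> on a null set makes no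
  difference.\<close>

definition ac_deriv :: "(real \<Rightarrow> 'a::real_normed_vector) \<Rightarrow> (real \<Rightarrow> 'a) \<Rightarrow> bool"
  where "ac_deriv f g \<longleftrightarrow> (\<forall>b\<ge>0. absolutely_continuous_on_interval 0 b f) \<and>
    (AE x in lebesgue. 0 \<le> x \<longrightarrow> (f has_vector_derivative g x) (at x within {0..}))"

text \<open>The exceptional set of the almost everywhere derivative becomes the \<open>N\<close> of
  \<open>FTC_absolutely_continuous\<close>. Every later estimate of increments rests on this
  identity.\<close>

lemma ac_deriv_integral:
  fixes f :: "real \<Rightarrow> 'a::banach"
  assumes f: "ac_deriv f g" and "0 \<le> s" "s \<le> t"
  shows "(g has_integral (f t - f s)) {s..t}"
proof -
  obtain N where N: "negligible N"
    "{x. \<not> (0 \<le> x \<longrightarrow> (f has_vector_derivative g x) (at x within {0..}))} \<subseteq> N"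
    using f unfolding ac_deriv_def eventually_ae_filter_negligible by auto
  have "absolutely_continuous_on_interval 0 t f"
    using f assms(2,3) by (simp add: ac_deriv_def)
  then have ac: "absolutely_continuous_on_interval s t f"
    by (rule AC_subinterval) (use assms(2) in simp)
  show ?thesis
  proof (rule FTC_absolutely_continuous[OF \<open>s \<le> t\<close> ac N(1)])
    fix x assume x: "x \<in> {s..t} - N"
    then have "x \<notin> N" "0 \<le> x"
      using assms(2) by auto
    then have "(f has_vector_derivative g x) (at x within {0..})"
      using N(2) by blast
    then show "(f has_vector_derivative g x) (at x within {s..t})"
      by (rule has_vector_derivative_within_subset) (use assms(2) in auto)
  qed
qed

lemma ac_deriv_continuous_on:
  assumes "ac_deriv f g"
  shows "continuous_on {0..t} f"
proof (cases "t \<ge> 0")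
  case True
  then show ?thesis
    using assms by (auto simp: ac_deriv_def intro: AC_imp_continuous_on)
qed auto

lemma ac_deriv_cong:
  assumes "ac_deriv f g" "\<And>x. 0 \<le> x \<Longrightarrow> g x = g' x"
  shows "ac_deriv f g'"
  using assms by (simp add: ac_deriv_def cong: imp_cong)

section \<open>Calculus rules for almost everywhere derivatives\<close>

lemma ac_deriv_bounded_linear:
  fixes f g :: "real \<Rightarrow> 'a::real_normed_vector"
  assumes T: "bounded_linear T" and f: "ac_deriv f g"
  shows "ac_deriv (\<lambda>x. T (f x)) (\<lambda>x. T (g x))"
  unfolding ac_deriv_def
proof (intro conjI allI impI)
  interpret bounded_linear T by (rule T)
  obtain K where K: "\<And>x. norm (T x) \<le> norm x * K"
    using bounded by blast
  fix b :: real assume "b \<ge> 0"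
  then have ac: "absolutely_continuous_on_interval 0 b f"
    using f by (simp add: ac_deriv_def)
  show "absolutely_continuous_on_interval 0 b (\<lambda>x. T (f x))"
  proof (rule AC_dominated[OF ac ac])
    fix x y
    have "norm (T (f y) - T (f x)) \<le> norm (f y - f x) * K"
      using K[of "f y - f x"] by (simp add: diff)
    \<comment> \<open>The constant is halved because \<open>f\<close> serves as both comparison
      functions.\<close>
    then show "norm (T (f y) - T (f x)) \<le> K / 2 * (norm (f y - f x) + norm (f y - f x))"
      by (simp add: algebra_simps)
  qed
next
  show "AE x in lebesgue. 0 \<le> x \<longrightarrow> ((\<lambda>x. T (f x)) has_vector_derivative T (g x)) (at x within {0..})"
    using f unfolding ac_deriv_def
    by (auto elim!: eventually_mono intro: bounded_linear.has_vector_derivative[OF T])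
qed

lemma ac_deriv_diff:
  fixes f1 f2 :: "real \<Rightarrow> 'a::real_normed_vector"
  assumes 1: "ac_deriv f1 g1" and 2: "ac_deriv f2 g2"
  shows "ac_deriv (\<lambda>x. f1 x - f2 x) (\<lambda>x. g1 x - g2 x)"
  unfolding ac_deriv_def
proof (intro conjI allI impI)
  fix b :: real assume "b \<ge> 0"
  then have ac: "absolutely_continuous_on_interval 0 b f1" "absolutely_continuous_on_interval 0 b f2"
    using 1 2 by (auto simp: ac_deriv_def)
  show "absolutely_continuous_on_interval 0 b (\<lambda>x. f1 x - f2 x)"
  proof (rule AC_dominated[OF ac])
    fix x y
    have "(f1 y - f2 y) - (f1 x - f2 x) = (f1 y - f1 x) - (f2 y - f2 x)"
      by simp
    then show "norm ((f1 y - f2 y) - (f1 x - f2 x)) \<le> 1 * (norm (f1 y - f1 x) + norm (f2 y - f2 x))"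
      by (metis norm_triangle_ineq4 mult_1)
  qed
next
  show "AE x in lebesgue. 0 \<le> x \<longrightarrow>
      ((\<lambda>x. f1 x - f2 x) has_vector_derivative g1 x - g2 x) (at x within {0..})"
    using 1 2 unfolding ac_deriv_def
    by (auto elim!: eventually_elim2 intro: has_vector_derivative_diff)
qed

text \<open>A bilinear map is Lipschitz only on bounded sets, and \<open>f1\<close> and
  \<open>f2\<close> are bounded on each \<open>{0..b}\<close> by continuity. Used for inner
  products, scalar multiplication and exponential weights.\<close>

lemma ac_deriv_bilinear:
  fixes f1 :: "real \<Rightarrow> 'a::real_normed_vector" and f2 :: "real \<Rightarrow> 'b::real_normed_vector"
  assumes B: "bounded_bilinear B" and 1: "ac_deriv f1 g1" and 2: "ac_deriv f2 g2"
  shows "ac_deriv (\<lambda>x. B (f1 x) (f2 x)) (\<lambda>x. B (f1 x) (g2 x) + B (g1 x) (f2 x))"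
  unfolding ac_deriv_def
proof (intro conjI allI impI)
  interpret bounded_bilinear B by (rule B)
  obtain K where K: "K > 0" "\<And>x y. norm (B x y) \<le> norm x * norm y * K"
    using pos_bounded by blast
  fix b :: real assume "b \<ge> 0"
  then have ac: "absolutely_continuous_on_interval 0 b f1" "absolutely_continuous_on_interval 0 b f2"
    using 1 2 by (auto simp: ac_deriv_def)
  have "bounded (f1 ` {0..b})" "bounded (f2 ` {0..b})"
    using ac by (auto intro!: compact_imp_bounded compact_continuous_image AC_imp_continuous_on)
  then obtain M1 M2 where M: "\<And>x. x \<in> {0..b} \<Longrightarrow> norm (f1 x) \<le> M1"
    "\<And>x. x \<in> {0..b} \<Longrightarrow> norm (f2 x) \<le> M2"
    by (force simp: bounded_iff)
  show "absolutely_continuous_on_interval 0 b (\<lambda>x. B (f1 x) (f2 x))"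
  proof (rule AC_dominated[OF ac])
    fix x y assume xy: "x \<in> {0..b}" "y \<in> {0..b}"
    define M where "M = max M1 M2"
    have M': "norm (f1 x) \<le> M" "norm (f2 y) \<le> M"
      using M xy by (auto simp: M_def intro: max.coboundedI1 max.coboundedI2)
    have "B (f1 y) (f2 y) - B (f1 x) (f2 x) = B (f1 y - f1 x) (f2 y) + B (f1 x) (f2 y - f2 x)"
      by (simp add: diff_left diff_right)
    then have "norm (B (f1 y) (f2 y) - B (f1 x) (f2 x))
      \<le> norm (B (f1 y - f1 x) (f2 y)) + norm (B (f1 x) (f2 y - f2 x))"
      by (metis norm_triangle_ineq)
    also have "\<dots> \<le> norm (f1 y - f1 x) * norm (f2 y) * K + norm (f1 x) * norm (f2 y - f2 x) * K"
      by (intro add_mono K)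
    also have "\<dots> \<le> norm (f1 y - f1 x) * M * K + M * norm (f2 y - f2 x) * K"
      using M' K(1) order_trans[OF norm_ge_zero M'(1)] by (intro add_mono mult_mono order_refl) auto
    finally show "norm (B (f1 y) (f2 y) - B (f1 x) (f2 x))
        \<le> (M * K) * (norm (f1 y - f1 x) + norm (f2 y - f2 x))"
      by (simp add: algebra_simps)
  qed
next
  show "AE x in lebesgue. 0 \<le> x \<longrightarrow>
      ((\<lambda>x. B (f1 x) (f2 x)) has_vector_derivative B (f1 x) (g2 x) + B (g1 x) (f2 x)) (at x within {0..})"
    using 1 2 unfolding ac_deriv_def
    by (auto elim!: eventually_elim2 intro: bounded_bilinear.has_vector_derivative[OF B])
qed

text \<open>By the mean value inequality \<open>f\<close> is Lipschitz on each compact interval.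
  This brings in the exponential factors.\<close>

lemma ac_deriv_C1:
  fixes f g :: "real \<Rightarrow> 'a::real_normed_vector"
  assumes d: "\<And>x. (f has_vector_derivative g x) (at x)" and g: "continuous_on UNIV g"
  shows "ac_deriv f g"
  unfolding ac_deriv_def
proof (intro conjI allI impI)
  fix b :: real assume "b \<ge> 0"
  have "bounded (g ` {0..b})"
    using g by (intro compact_imp_bounded compact_continuous_image) (auto intro: continuous_on_subset)
  then obtain M where M: "\<And>x. x \<in> {0..b} \<Longrightarrow> norm (g x) \<le> M"
    by (force simp: bounded_iff)
  show "absolutely_continuous_on_interval 0 b f"
  proof (rule AC_dominated[OF AC_ident AC_ident])
    fix x y assume xy: "x \<in> {0..b}" "y \<in> {0..b}"
    have "norm (f y - f x) \<le> M * norm (y - x)"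
    proof (rule differentiable_bound[where f'="\<lambda>x h. h *\<^sub>R g x" and S="{0..b}"])
      fix u assume "u \<in> {0..b}"
      then show "onorm (\<lambda>h. h *\<^sub>R g u) \<le> M"
        using M[of u] by (intro onorm_le) (simp add: mult.commute[of M] mult_left_mono)
      show "(f has_derivative (\<lambda>h. h *\<^sub>R g u)) (at u within {0..b})"
        using d[of u] by (auto simp: has_vector_derivative_def intro: has_derivative_at_withinI)
    qed (use xy in auto)
    then show "norm (f y - f x) \<le> M / 2 * (norm (y - x) + norm (y - x))"
      by simp
  qed
next
  show "AE x in lebesgue. 0 \<le> x \<longrightarrow> (f has_vector_derivative g x) (at x within {0..})"
    using d by (simp add: has_vector_derivative_at_within)
qed

lemma ac_deriv_exp: "ac_deriv (\<lambda>x. exp (c * of_real x)) (\<lambda>x. c * exp (c * of_real x))" for c :: complex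
proof (rule ac_deriv_C1)
  show "((\<lambda>x. exp (c * of_real x)) has_vector_derivative c * exp (c * of_real x)) (at x)" for x :: real
  proof -
    have "((\<lambda>x. exp (c * x)) has_field_derivative c * exp (c * of_real x)) (at (of_real x))"
      by (auto intro!: derivative_eq_intros)
    from has_vector_derivative_real_field[OF this] show ?thesis .
  qed
qed (intro continuous_intros)

lemma ac_deriv_real_exp: "ac_deriv (\<lambda>x. exp (c * x)) (\<lambda>x. c * exp (c * x))" for c :: real
proof (rule ac_deriv_C1)
  show "((\<lambda>x. exp (c * x)) has_vector_derivative c * exp (c * x)) (at x)" for x
    by (auto intro!: derivative_eq_intros simp: has_real_derivative_iff_has_vector_derivative[symmetric])
qed (intro continuous_intros)

section \<open>Growth estimates and a Gronwall inequality\<close>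

lemma ac_deriv_growth_le:
  fixes f g :: "real \<Rightarrow> real"
  assumes f: "ac_deriv f g" and g: "\<And>x. 0 \<le> x \<Longrightarrow> g x \<le> C" and st: "0 \<le> s" "s \<le> t"
  shows "f t \<le> f s + C * (t - s)"
proof -
  have "f t - f s \<le> (t - s) * C"
  proof (rule has_integral_le[OF ac_deriv_integral[OF f st]])
    show "((\<lambda>x. C) has_integral (t - s) * C) {s..t}"
      using has_integral_const_real[of C s t] st by simp
  qed (use g st in auto)
  then show ?thesis
    by (simp add: mult.commute)
qed

lemma ac_deriv_norm_diff_le:
  fixes f g :: "real \<Rightarrow> 'a::banach"
  assumes f: "ac_deriv f g" and k: "k integrable_on {s..t}" and st: "0 \<le> s" "s \<le> t"
    and le: "\<And>x. x \<in> {s..t} \<Longrightarrow> norm (g x) \<le> k x"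
  shows "norm (f t - f s) \<le> integral {s..t} k"
proof -
  have g: "(g has_integral (f t - f s)) {s..t}"
    by (rule ac_deriv_integral[OF f st])
  show ?thesis
    using integral_norm_bound_integral[OF has_integral_integrable[OF g] k le] integral_unique[OF g] by simp
qed

text \<open>At a point \<open>y\<close> where the norm of \<open>f\<close> is maximal on
  \<open>{s..t}\<close>, the increment from \<open>s\<close> is at most half of
  \<open>norm (f y)\<close> and can be absorbed.\<close>

lemma ac_deriv_gronwall_step:
  fixes f g :: "real \<Rightarrow> 'a::banach"
  assumes f: "ac_deriv f g" and k: "k integrable_on {s..t}" "\<And>x. 0 \<le> x \<Longrightarrow> 0 \<le> k x"
    and le: "\<And>x. 0 \<le> x \<Longrightarrow> norm (g x) \<le> k x * norm (f x)"
    and st: "0 \<le> s" "s \<le> t" and small: "integral {s..t} k \<le> 1 / 2"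
  shows "norm (f t) \<le> 2 * norm (f s)"
proof -
  have "continuous_on {s..t} (\<lambda>x. norm (f x))"
    using ac_deriv_continuous_on[OF f, of t] st
    by (intro continuous_on_norm) (auto intro: continuous_on_subset)
  then obtain y where y: "y \<in> {s..t}" and max: "\<And>x. x \<in> {s..t} \<Longrightarrow> norm (f x) \<le> norm (f y)"
    using continuous_attains_sup[of "{s..t}" "\<lambda>x. norm (f x)"] st by auto
  have ky: "k integrable_on {s..y}"
    using k(1) by (rule integrable_on_subinterval) (use y in auto)
  have "norm (f y - f s) \<le> integral {s..y} (\<lambda>x. k x * norm (f y))"
  proof (rule ac_deriv_norm_diff_le[OF f])
    fix x assume x: "x \<in> {s..y}"
    then have "norm (g x) \<le> k x * norm (f x)"
      using st by (intro le) auto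
    also have "\<dots> \<le> k x * norm (f y)"
      using x y st by (intro mult_left_mono max k(2)) auto
    finally show "norm (g x) \<le> k x * norm (f y)" .
  qed (use ky st y in \<open>auto intro: integrable_on_mult_left\<close>)
  also have "\<dots> = integral {s..y} k * norm (f y)"
    by simp
  also have "\<dots> \<le> 1 / 2 * norm (f y)"
  proof (intro mult_right_mono norm_ge_zero)
    have "integral {s..y} k \<le> integral {s..t} k"
      using y st k(2) by (intro integral_subset_le ky k(1)) auto
    then show "integral {s..y} k \<le> 1 / 2"
      using small by simp
  qed
  finally have "norm (f y) \<le> 2 * norm (f s)"
    using norm_triangle_sub[of "f y" "f s"] by simp
  then show ?thesis
    using max[of t] st by simp
qed

text \<open>The growth factor is 2 per half unit of mass of k, not the optimal exp; this avoids
  differentiating the indefinite integral of k.\<close>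
lemma ac_deriv_gronwall:
  fixes f g :: "real \<Rightarrow> 'a::banach"
  assumes f: "ac_deriv f g" and k: "\<And>t. k integrable_on {0..t}" "\<And>x. 0 \<le> x \<Longrightarrow> 0 \<le> k x"
    and le: "\<And>x. 0 \<le> x \<Longrightarrow> norm (g x) \<le> k x * norm (f x)"
    and "0 \<le> t" "integral {0..t} k \<le> real (Suc n) / 2"
  shows "norm (f t) \<le> 2 ^ Suc n * norm (f 0)"
  using assms(5,6)
proof (induction n arbitrary: t)
  case 0
  then show ?case
    using ac_deriv_gronwall_step[OF f k(1,2) le order_refl, of t] by simp
next
  case (Suc n)
  show ?case
  proof (cases "integral {0..t} k \<le> real (Suc n) / 2")
    case True
    then have "norm (f t) \<le> 2 ^ Suc n * norm (f 0)"
      using Suc by blast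
    also have "\<dots> \<le> 2 ^ Suc (Suc n) * norm (f 0)"
      by (intro mult_right_mono power_increasing) auto
    finally show ?thesis .
  next
    case False
    \<comment> \<open>The indefinite integral is continuous, so some \<open>s\<close> carries
      exactly \<open>Suc n\<close> half units of mass, leaving at most one half unit for a single
      step.\<close>
    have "\<exists>s\<ge>0. s \<le> t \<and> integral {0..s} k = real (Suc n) / 2"
      using False Suc.prems k(1) by (intro IVT' indefinite_integral_continuous_1) auto
    then obtain s where s: "0 \<le> s" "s \<le> t" "integral {0..s} k = real (Suc n) / 2"
      by blast
    have "integral {0..s} k + integral {s..t} k = integral {0..t} k"
      using s k(1) by (intro Henstock_Kurzweil_Integration.integral_combine) auto
    then have "integral {s..t} k \<le> 1 / 2"
      using s(3) Suc.prems(2) by (simp add: field_simps)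
    moreover have "k integrable_on {s..t}"
      using k(1)[of t] by (rule integrable_on_subinterval) (use s in auto)
    ultimately have "norm (f t) \<le> 2 * norm (f s)"
      by (intro ac_deriv_gronwall_step[OF f _ k(2) le s(1,2)])
    also have "norm (f s) \<le> 2 ^ Suc n * norm (f 0)"
      using s by (intro Suc.IH) auto
    finally show ?thesis
      by simp
  qed
qed

section \<open>Integrable functions on a half-line\<close>

lemma not_integrable_bounded_below:
  fixes f :: "real \<Rightarrow> real"
  assumes f: "f integrable_on {a..}" "\<And>x. a \<le> x \<Longrightarrow> 0 \<le> f x"
    and "d > 0" "a \<le> s"
  shows "\<exists>x\<ge>s. f x < d"
proof (rule ccontr)
  assume "\<not> (\<exists>x\<ge>s. f x < d)"
  then have le: "d \<le> f x" if "s \<le> x" for x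
    using that by force
  \<comment> \<open>Chosen so that \<open>d * (t - s)\<close> exceeds the whole integral by
    1.\<close>
  define t where "t = s + (integral {a..} f + 1) / d"
  have I: "0 \<le> integral {a..} f"
    using f by (intro integral_nonneg) auto
  then have t: "s \<le> t"
    using \<open>d > 0\<close> by (simp add: t_def)
  have fst: "f integrable_on {s..t}"
    by (rule integrable_on_subinterval[OF f(1)]) (use assms t in auto)
  have "integral {s..t} (\<lambda>x. d) \<le> integral {s..t} f"
    using fst le by (intro integral_le) auto
  also have "\<dots> \<le> integral {a..} f"
    using assms t by (intro integral_subset_le fst f) auto
  finally show False
    using t \<open>d > 0\<close> by (simp add: t_def)
qed

lemma integral_tail_small:
  fixes f :: "real \<Rightarrow> real"
  assumes "f integrable_on {0..}" "e > 0"
  obtains l where "0 \<le> l" "\<bar>integral {0..} f - integral {0..l} f\<bar> < e"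
proof -
  obtain B where B: "B > 0" "\<And>a b. ball 0 B \<subseteq> cbox a b \<Longrightarrow>
      norm (integral (cbox a b) (\<lambda>x. if x \<in> {0..} then f x else 0) - integral {0..} f) < e"
    using integrable_integral[OF assms(1)] assms(2) unfolding has_integral_alt' by metis
  \<comment> \<open>The integrand vanishes on the negative axis, so the symmetric box only
    contributes \<open>{0..B}\<close>.\<close>
  have "integral (cbox (- B) B) (\<lambda>x. if x \<in> {0..} then f x else 0) = integral {0..B} f"
    unfolding integral_restrict_Int by (rule arg_cong2[where f=integral]) (use B(1) in auto)
  moreover have "ball 0 B \<subseteq> cbox (- B) B"
    by (auto simp: dist_real_def)
  ultimately show ?thesis
    using B(1) B(2)[of "-B" B] that[of B] by (simp add: abs_minus_commute)
qed

section \<open>Norms and adjoints of complex vectors and matrices\<close>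

lemma norm_vector_scalar_mult: "norm (c *s x) = norm c * norm x"
  for x :: "'a::real_normed_div_algebra^'n"
  unfolding norm_vec_def vector_scalar_mult_def
  by (simp add: norm_mult L2_set_right_distrib)

lemma bounded_bilinear_vector_scalar_mult:
  "bounded_bilinear ((*s) :: 'a::real_normed_field \<Rightarrow> 'a^'n \<Rightarrow> 'a^'n)"
proof
  show "\<exists>K. \<forall>(a::'a) (b::'a^'n). norm (a *s b) \<le> norm a * norm b * K"
    by (intro exI[of _ 1]) (simp add: norm_vector_scalar_mult)
qed (auto simp: vec_eq_iff algebra_simps)

lemma ctranspose_mult: "ctranspose (A ** B) = ctranspose B ** ctranspose A"
  for A :: "complex^'n^'m" and B :: "complex^'k^'n"
  by (simp add: ctranspose_def map_matrix_def transpose_def matrix_matrix_mult_def vec_eq_iff mult.commute)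

lemma bounded_linear_matrix_vector_mult_left:
  "bounded_linear (\<lambda>M :: complex^'n^'m. M *v p)"
  unfolding linear_conv_bounded_linear[symmetric]
  by (rule linearI)
    (simp_all add: vec_eq_iff matrix_vector_mult_def sum.distrib algebra_simps scaleR_sum_right)

text \<open>Reduces the continuity of a matrix function to that of its columns, that is, to finitely
  many unit vectors \<open>h\<close>.\<close>

lemma norm_matrix_le:
  fixes M :: "complex^'n^'m"
  assumes "\<And>j. norm (M *v axis j 1) \<le> e"
  shows "norm M \<le> real CARD('m) * real CARD('n) * e"
proof -
  have "cmod (M $ i $ j) \<le> e" for i j
  proof -
    have "M $ i $ j = (M *v axis j 1) $ i"
      by (simp add: matrix_vector_mult_def axis_def if_distrib cong: if_cong)
    then show ?thesis
      using assms[of j] Finite_Cartesian_Product.norm_nth_le[of "M *v axis j 1" i] by simp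
  qed
  then have "norm (M $ i) \<le> (\<Sum>j\<in>(UNIV::'n set). e)" for i
    unfolding norm_vec_def by (intro order_trans[OF L2_set_le_sum] sum_mono) auto
  then have "norm M \<le> (\<Sum>i\<in>(UNIV::'m set). \<Sum>j\<in>(UNIV::'n set). e)"
    unfolding norm_vec_def[of M] by (intro order_trans[OF L2_set_le_sum] sum_mono) auto
  then show ?thesis
    by simp
qed

lemma inner_complex_vec: "x \<bullet> y = Re (\<Sum>i\<in>UNIV. x $ i * cnj (y $ i))" for x y :: "complex^'n"
  by (simp add: inner_vec_def inner_complex_def)

text \<open>The inner product here is real, namely the real part of the Hermitian form, so the
  adjoint is still the conjugate transpose.\<close>

lemma inner_matrix_vector_adjoint: "x \<bullet> (M *v y) = (ctranspose M *v x) \<bullet> y"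
  for M :: "complex^'n^'m"
proof -
  have "(\<Sum>i\<in>UNIV. x $ i * cnj ((M *v y) $ i)) = (\<Sum>i\<in>UNIV. \<Sum>k\<in>UNIV. cnj (M $ i $ k) * x $ i * cnj (y $ k))"
    by (simp add: matrix_vector_mult_def sum_distrib_left mult_ac)
  also have "\<dots> = (\<Sum>k\<in>UNIV. (ctranspose M *v x) $ k * cnj (y $ k))"
    by (subst sum.swap) (simp add: matrix_vector_mult_def sum_distrib_right ctranspose_def map_matrix_def transpose_def)
  finally show ?thesis
    by (simp add: inner_complex_vec)
qed

lemma inner_scalar_mult_left: "(c *s x) \<bullet> y = x \<bullet> (cnj c *s y)" for x y :: "complex^'n"
  by (simp add: inner_complex_vec mult_ac)

lemma inner_scalar_mult_self: "x \<bullet> (c *s x) = Re c * (x \<bullet> x)" for x :: "complex^'n"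
  by (auto simp: inner_vec_def inner_complex_def sum_distrib_left power2_eq_square algebra_simps
      simp del: mult_cancel_left intro!: sum.cong)

lemma inner_scalar_mult_both: "(c *s x) \<bullet> (c *s x) = (cmod c)\<^sup>2 * (x \<bullet> x)" for x :: "complex^'n"
  by (simp only: power2_norm_eq_inner[symmetric] norm_vector_scalar_mult power_mult_distrib)

text \<open>A crude matrix norm with three convenient features: it is integrable as soon as the
  entries are absolutely integrable, it dominates the operator norm, and conjugate transposition
  preserves it.\<close>

definition entry_sum :: "complex^'n^'m \<Rightarrow> real"
  where "entry_sum M = (\<Sum>i\<in>UNIV. \<Sum>k\<in>UNIV. cmod (M $ i $ k))"

lemma entry_sum_nonneg: "0 \<le> entry_sum M"
  by (simp add: entry_sum_def sum_nonneg)

lemma norm_matrix_vector_le_entry_sum: "norm (M *v x) \<le> entry_sum M * norm x"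
proof -
  have "norm (M *v x) \<le> (\<Sum>i\<in>UNIV. cmod ((M *v x) $ i))"
    by (simp add: norm_vec_def L2_set_le_sum)
  also have "\<dots> \<le> (\<Sum>i\<in>UNIV. \<Sum>k\<in>UNIV. cmod (M $ i $ k) * norm x)"
  proof (rule sum_mono)
    fix i
    have "cmod ((M *v x) $ i) \<le> (\<Sum>k\<in>UNIV. cmod (M $ i $ k * x $ k))"
      unfolding matrix_vector_mult_def by (simp add: norm_sum)
    also have "\<dots> \<le> (\<Sum>k\<in>UNIV. cmod (M $ i $ k) * norm x)"
      by (intro sum_mono) (simp add: norm_mult mult_left_mono Finite_Cartesian_Product.norm_nth_le)
    finally show "cmod ((M *v x) $ i) \<le> (\<Sum>k\<in>UNIV. cmod (M $ i $ k) * norm x)" .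
  qed
  finally show ?thesis
    by (simp add: entry_sum_def sum_distrib_right)
qed

lemma entry_sum_ctranspose: "entry_sum (ctranspose M) = entry_sum M"
  unfolding entry_sum_def
  by (subst sum.swap) (simp add: ctranspose_def map_matrix_def transpose_def)

text \<open>The integrating factor, used both for the rescaling by \<open>exp(-izx)\<close> and for
  removing the diagonal term of the lower block.\<close>

lemma ac_deriv_scalar_exp:
  fixes f g :: "real \<Rightarrow> complex^'n"
  assumes "ac_deriv f g"
  shows "ac_deriv (\<lambda>x. exp (c * of_real x) *s f x)
    (\<lambda>x. exp (c * of_real x) *s (g x + c *s f x))"
  by (rule ac_deriv_cong[OF ac_deriv_bilinear[OF bounded_bilinear_vector_scalar_mult ac_deriv_exp assms]])
    (simp add: vec_eq_iff algebra_simps)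

section \<open>The rescaled Dirac system\<close>

text \<open>A and B stand for the two blocks of a solution of the Dirac system multiplied by exp(-izx).\<close>
definition scaled_dirac ::
  "(real \<Rightarrow> complex^'m2^'m1) \<Rightarrow> complex \<Rightarrow> (real \<Rightarrow> complex^'m1) \<Rightarrow> (real \<Rightarrow> complex^'m2) \<Rightarrow> bool"
  where "scaled_dirac v z A B \<longleftrightarrow>
    ac_deriv A (\<lambda>x. \<i> *s (v x *v B x)) \<and>
    ac_deriv B (\<lambda>x. (-2 * \<i> * z) *s B x - \<i> *s (ctranspose (v x) *v A x))"

text \<open>Moving \<open>v x\<close> across the inner product turns \<open>\<i>\<close> into
  \<open>-\<i>\<close>, so the potential terms of the two squares cancel. The remainder
  \<open>r\<close> is 0 for one solution and carries the parameter mismatch for a difference of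
  two.\<close>

lemma energy_ac_deriv:
  fixes v :: "real \<Rightarrow> complex^'m2^'m1"
  assumes P: "ac_deriv P (\<lambda>x. \<i> *s (v x *v Q x))"
    and Q: "ac_deriv Q (\<lambda>x. c *s Q x - \<i> *s (ctranspose (v x) *v P x) + r x)"
  shows "ac_deriv (\<lambda>x. P x \<bullet> P x - Q x \<bullet> Q x) (\<lambda>x. - 2 * (Re c * (Q x \<bullet> Q x) + Q x \<bullet> r x))"
proof (rule ac_deriv_cong)
  show "ac_deriv (\<lambda>x. P x \<bullet> P x - Q x \<bullet> Q x) (\<lambda>x.
     (P x \<bullet> (\<i> *s (v x *v Q x)) + (\<i> *s (v x *v Q x)) \<bullet> P x) -
     (Q x \<bullet> (c *s Q x - \<i> *s (ctranspose (v x) *v P x) + r x)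
       + (c *s Q x - \<i> *s (ctranspose (v x) *v P x) + r x) \<bullet> Q x))"
    by (intro ac_deriv_diff ac_deriv_bilinear bounded_bilinear_inner P Q)
  fix x
  have "P x \<bullet> (\<i> *s (v x *v Q x)) = ((- \<i>) *s P x) \<bullet> (v x *v Q x)"
    by (simp add: inner_scalar_mult_left)
  also have "\<dots> = ((- \<i>) *s (ctranspose (v x) *v P x)) \<bullet> Q x"
    by (simp only: inner_matrix_vector_adjoint vector_scalar_commute)
  also have "(- \<i>) *s (ctranspose (v x) *v P x) = - (\<i> *s (ctranspose (v x) *v P x))"
    by (simp add: vec_eq_iff)
  finally have "P x \<bullet> (\<i> *s (v x *v Q x)) = - (Q x \<bullet> (\<i> *s (ctranspose (v x) *v P x)))"
    by (simp add: inner_commute)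
  then show "(P x \<bullet> (\<i> *s (v x *v Q x)) + (\<i> *s (v x *v Q x)) \<bullet> P x) -
     (Q x \<bullet> (c *s Q x - \<i> *s (ctranspose (v x) *v P x) + r x)
       + (c *s Q x - \<i> *s (ctranspose (v x) *v P x) + r x) \<bullet> Q x)
    = - 2 * (Re c * (Q x \<bullet> Q x) + Q x \<bullet> r x)"
    by (simp add: inner_add_right inner_diff_right inner_scalar_mult_self inner_commute algebra_simps)
qed

text \<open>The energy E decreases and is dominated by an integrable function, so it cannot become negative.\<close>
lemma scaled_dirac_contractive:
  assumes S: "scaled_dirac v z A B" and z: "0 < Im z"
    and int: "(\<lambda>x. exp (-2 * Im z * x) * (A x \<bullet> A x + B x \<bullet> B x)) integrable_on {0..}"
    and "0 \<le> s"
  shows "norm (B s) \<le> norm (A s)"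
proof -
  have B: "ac_deriv B (\<lambda>x. (-2 * \<i> * z) *s B x - \<i> *s (ctranspose (v x) *v A x) + 0)"
    using S by (simp add: scaled_dirac_def)
  \<comment> \<open>The weight undoes the rescaling: \<open>E\<close> is the difference of the
    squared norms of the two blocks of the original solution.\<close>
  define E where "E x = exp (-2 * Im z * x) * (A x \<bullet> A x - B x \<bullet> B x)" for x
  have E: "ac_deriv E (\<lambda>x. exp (-2 * Im z * x) * (- 2 * (Re (-2 * \<i> * z) * (B x \<bullet> B x) + B x \<bullet> 0))
      + (-2 * Im z) * exp (-2 * Im z * x) * (A x \<bullet> A x - B x \<bullet> B x))"
    unfolding E_def
    using energy_ac_deriv[OF _ B] S
    by (intro ac_deriv_bilinear bounded_bilinear_mult ac_deriv_real_exp) (auto simp: scaled_dirac_def)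
  have E_le: "E t \<le> E s" if "s \<le> t" for t
  proof -
    have "E t \<le> E s + 0 * (t - s)"
    proof (rule ac_deriv_growth_le[OF E])
      fix x :: real
      \<comment> \<open>The derivative of \<open>E\<close> equals -2 times this quantity.\<close>
      have "0 \<le> Im z * exp (-2 * Im z * x) * (A x \<bullet> A x + B x \<bullet> B x)"
        using z by simp
      then show "exp (-2 * Im z * x) * (- 2 * (Re (-2 * \<i> * z) * (B x \<bullet> B x) + B x \<bullet> 0))
        + (-2 * Im z) * exp (-2 * Im z * x) * (A x \<bullet> A x - B x \<bullet> B x) \<le> 0"
        by (simp add: algebra_simps)
    qed (use that assms in auto)
    then show ?thesis
      by simp
  qed
  have "0 \<le> E s"
  proof (rule ccontr)
    assume "\<not> 0 \<le> E s"
    then obtain t where t: "s \<le> t" "exp (-2 * Im z * t) * (A t \<bullet> A t + B t \<bullet> B t) < - E s"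
      using not_integrable_bounded_below[OF int, of "- E s" s] \<open>0 \<le> s\<close> by auto
    \<comment> \<open>Past \<open>s\<close> the values of \<open>E\<close> stay at most
      \<open>E s < 0\<close>, which keeps the integrable function at or above \<open>- E s\<close>;
      at the chosen \<open>t\<close> it is smaller.\<close>
    have "- E t \<le> exp (-2 * Im z * t) * (A t \<bullet> A t + B t \<bullet> B t)"
      by (simp add: E_def algebra_simps)
    then show False
      using t E_le[of t] by linarith
  qed
  then show ?thesis
    by (simp add: E_def zero_le_mult_iff norm_eq_sqrt_inner)
qed

text \<open>Contractivity closes the equation for \<open>A\<close>: its right-hand side is at most
  \<open>entry_sum (v x) * norm (A x)\<close>. Gronwall then gives a factor governed by the integral
  of \<open>entry_sum (v x)\<close> and independent of \<open>z\<close>.\<close>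

lemma scaled_dirac_bounded:
  assumes S: "scaled_dirac v z A B"
    and contr: "\<And>x. 0 \<le> x \<Longrightarrow> norm (B x) \<le> norm (A x)"
    and k: "(\<lambda>x. entry_sum (v x)) integrable_on {0..}"
    and n: "integral {0..} (\<lambda>x. entry_sum (v x)) \<le> real (Suc n) / 2"
    and "0 \<le> t"
  shows "norm (A t) \<le> 2 ^ Suc n * norm (A 0)"
proof (rule ac_deriv_gronwall)
  show "ac_deriv A (\<lambda>x. \<i> *s (v x *v B x))"
    using S by (simp add: scaled_dirac_def)
  show kt: "(\<lambda>x. entry_sum (v x)) integrable_on {0..t}" for t
    by (rule integrable_on_subinterval[OF k]) auto
  show "norm (\<i> *s (v x *v B x)) \<le> entry_sum (v x) * norm (A x)" if "0 \<le> x" for x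
    using norm_matrix_vector_le_entry_sum[of "v x" "B x"] mult_left_mono[OF contr[OF that] entry_sum_nonneg[of "v x"]]
    by (simp add: norm_vector_scalar_mult)
  have "integral {0..t} (\<lambda>x. entry_sum (v x)) \<le> integral {0..} (\<lambda>x. entry_sum (v x))"
    by (intro integral_subset_le kt k) (auto simp: entry_sum_nonneg)
  then show "integral {0..t} (\<lambda>x. entry_sum (v x)) \<le> real (Suc n) / 2"
    using n by linarith
qed (use assms entry_sum_nonneg in auto)

text \<open>Multiplying B by exp(2izx) removes the diagonal term of its equation, and the boundary term at t
  vanishes as t tends to infinity.\<close>
lemma scaled_dirac_tail:
  assumes S: "scaled_dirac v z A B" and z: "0 < Im z"
    and bd: "\<And>x. 0 \<le> x \<Longrightarrow> norm (A x) \<le> C" "\<And>x. 0 \<le> x \<Longrightarrow> norm (B x) \<le> C"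
    and k: "(\<lambda>x. entry_sum (v x)) integrable_on {0..}"
    and "0 \<le> l"
  shows "norm (B l) \<le> C * (integral {0..} (\<lambda>x. entry_sum (v x)) - integral {0..l} (\<lambda>x. entry_sum (v x)))"
    (is "_ \<le> C * ?\<tau>")
proof -
  let ?e = "\<lambda>x::real. exp (2 * \<i> * z * of_real x)"
  have e: "norm (?e x) = exp (-2 * Im z * x)" for x
    by simp
  have C: "0 \<le> C"
    using bd(1)[of 0] norm_ge_zero[of "A 0"] by linarith
  have kt: "(\<lambda>x. entry_sum (v x)) integrable_on {s..t}" if "0 \<le> s" for s t
    by (rule integrable_on_subinterval[OF k]) (use that in auto)
  have G: "ac_deriv (\<lambda>x. ?e x *s B x) (\<lambda>x. ?e x *s (- \<i> *s (ctranspose (v x) *v A x)))"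
  proof (rule ac_deriv_cong[OF ac_deriv_scalar_exp])
    show "ac_deriv B (\<lambda>x. (-2 * \<i> * z) *s B x - \<i> *s (ctranspose (v x) *v A x))"
      using S by (simp add: scaled_dirac_def)
  qed (simp add: vec_eq_iff algebra_simps)
  have le: "exp (-2 * Im z * l) * norm (B l)
      \<le> exp (-2 * Im z * t) * C + exp (-2 * Im z * l) * (C * ?\<tau>)" if t: "l \<le> t" for t
  proof -
    have "norm (?e t *s B t - ?e l *s B l)
      \<le> integral {l..t} (\<lambda>x. exp (-2 * Im z * l) * C * entry_sum (v x))"
    proof (rule ac_deriv_norm_diff_le[OF G])
      fix x assume x: "x \<in> {l..t}"
      have "norm (?e x *s (- \<i> *s (ctranspose (v x) *v A x)))
        = exp (-2 * Im z * x) * norm (ctranspose (v x) *v A x)"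
        using e[of x] norm_vector_scalar_mult[of "- \<i>" "ctranspose (v x) *v A x"]
        by (simp only: norm_vector_scalar_mult) simp
      \<comment> \<open>The weight is replaced by its value at the left endpoint \<open>l\<close>.
        This factor also multiplies \<open>norm (B l)\<close> and cancels at the end, which makes
        the bound uniform in \<open>z\<close>.\<close>
      also have "\<dots> \<le> exp (-2 * Im z * l) * (entry_sum (v x) * C)"
      proof (intro mult_mono)
        show "exp (-2 * Im z * x) \<le> exp (-2 * Im z * l)"
          using x z by simp
        have "norm (ctranspose (v x) *v A x) \<le> entry_sum (v x) * norm (A x)"
          using norm_matrix_vector_le_entry_sum[of "ctranspose (v x)" "A x"] by (simp add: entry_sum_ctranspose)
        also have "\<dots> \<le> entry_sum (v x) * C"
          using x \<open>0 \<le> l\<close> by (intro mult_left_mono bd entry_sum_nonneg) auto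
        finally show "norm (ctranspose (v x) *v A x) \<le> entry_sum (v x) * C" .
      qed auto
      finally show "norm (?e x *s (- \<i> *s (ctranspose (v x) *v A x)))
          \<le> exp (-2 * Im z * l) * C * entry_sum (v x)"
        by (simp add: mult_ac)
    qed (use kt t \<open>0 \<le> l\<close> in \<open>auto intro: integrable_on_mult_right\<close>)
    also have "\<dots> = exp (-2 * Im z * l) * C * integral {l..t} (\<lambda>x. entry_sum (v x))"
      by simp
    also have "\<dots> \<le> exp (-2 * Im z * l) * C * ?\<tau>"
    proof (intro mult_left_mono)
      have "integral {0..l} (\<lambda>x. entry_sum (v x)) + integral {l..t} (\<lambda>x. entry_sum (v x))
          = integral {0..t} (\<lambda>x. entry_sum (v x))"
        using t \<open>0 \<le> l\<close> kt by (intro Henstock_Kurzweil_Integration.integral_combine) auto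
      also have "\<dots> \<le> integral {0..} (\<lambda>x. entry_sum (v x))"
        using kt k by (intro integral_subset_le) (auto simp: entry_sum_nonneg)
      finally show "integral {l..t} (\<lambda>x. entry_sum (v x)) \<le> ?\<tau>"
        by simp
    qed (use C in auto)
    finally have "norm (?e t *s B t - ?e l *s B l) \<le> exp (-2 * Im z * l) * C * ?\<tau>" .
    moreover have "norm (?e l *s B l) \<le> norm (?e t *s B t) + norm (?e t *s B t - ?e l *s B l)"
      by (metis norm_minus_commute norm_triangle_sub)
    moreover have "norm (?e t *s B t) \<le> exp (-2 * Im z * t) * C"
      using bd(2)[of t] t \<open>0 \<le> l\<close> by (simp add: norm_vector_scalar_mult)
    ultimately have "norm (?e l *s B l) \<le> exp (-2 * Im z * t) * C + exp (-2 * Im z * l) * C * ?\<tau>"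
      by linarith
    then show ?thesis
      by (simp add: norm_vector_scalar_mult mult.assoc)
  qed
  have "((\<lambda>t. exp (-2 * Im z * t) * C + exp (-2 * Im z * l) * (C * ?\<tau>))
      \<longlongrightarrow> 0 * C + exp (-2 * Im z * l) * (C * ?\<tau>)) at_top"
    using z
    by (intro tendsto_intros filterlim_compose[OF exp_at_bot] filterlim_tendsto_neg_mult_at_bot[OF tendsto_const _ filterlim_ident]) auto
  then have "exp (-2 * Im z * l) * norm (B l) \<le> 0 * C + exp (-2 * Im z * l) * (C * ?\<tau>)"
    by (rule tendsto_lowerbound) (use le in \<open>auto simp: eventually_at_top_linorder\<close>)
  then show ?thesis
    by simp
qed

text \<open>The difference of two solutions satisfies the perturbed system of
  \<open>energy_ac_deriv\<close>. Its energy at 0 is minus the left-hand side, since the upper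
  blocks agree there, and its energy at \<open>l\<close> is at least minus the squared lower
  block.\<close>

lemma scaled_dirac_compare:
  assumes 1: "scaled_dirac v z A B" and 2: "scaled_dirac v w A' B'" and "A 0 = A' 0"
    and bd: "\<And>x. 0 \<le> x \<Longrightarrow> norm (B x) \<le> C" "\<And>x. 0 \<le> x \<Longrightarrow> norm (B' x) \<le> C"
    and "0 \<le> Im z" "0 \<le> l"
  shows "(norm (B 0 - B' 0))\<^sup>2 \<le> (norm (B l - B' l))\<^sup>2 + 8 * C\<^sup>2 * cmod (z - w) * l"
proof -
  define P where "P x = A x - A' x" for x
  define Q where "Q x = B x - B' x" for x
  \<comment> \<open>From \<open>- z B + w B' = - z (B - B') - (z - w) B'\<close>.\<close>
  define r where "r x = (-2 * \<i> * (z - w)) *s B' x" for x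
  have C: "0 \<le> C"
    using bd(1)[of 0] norm_ge_zero[of "B 0"] by linarith
  have "ac_deriv P (\<lambda>x. \<i> *s (v x *v B x) - \<i> *s (v x *v B' x))"
    unfolding P_def using 1 2 by (intro ac_deriv_diff) (auto simp: scaled_dirac_def)
  then have P: "ac_deriv P (\<lambda>x. \<i> *s (v x *v Q x))"
    by (rule ac_deriv_cong) (simp add: Q_def matrix_vector_mult_diff_distrib vec_eq_iff algebra_simps)
  have "ac_deriv Q (\<lambda>x. ((-2 * \<i> * z) *s B x - \<i> *s (ctranspose (v x) *v A x))
      - ((-2 * \<i> * w) *s B' x - \<i> *s (ctranspose (v x) *v A' x)))"
    unfolding Q_def using 1 2 by (intro ac_deriv_diff) (auto simp: scaled_dirac_def)
  then have Q: "ac_deriv Q (\<lambda>x. (-2 * \<i> * z) *s Q x - \<i> *s (ctranspose (v x) *v P x) + r x)"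
    by (rule ac_deriv_cong)
      (simp add: Q_def P_def r_def matrix_vector_mult_diff_distrib vec_eq_iff algebra_simps)
  have "P l \<bullet> P l - Q l \<bullet> Q l \<le> P 0 \<bullet> P 0 - Q 0 \<bullet> Q 0 + 8 * C\<^sup>2 * cmod (z - w) * (l - 0)"
  proof (rule ac_deriv_growth_le[OF energy_ac_deriv[OF P Q]])
    fix x :: real assume x: "0 \<le> x"
    \<comment> \<open>Source of the 8: a factor 2 from each of \<open>Q\<close> and
      \<open>r\<close>, and 2 from differentiating the squares. The term with
      \<open>Re (-2 * \<i> * z) = 2 * Im z\<close> has a favourable sign and is dropped.\<close>
    have "norm (Q x) \<le> 2 * C"
      using norm_triangle_ineq4[of "B x" "B' x"] bd[OF x] by (simp add: Q_def)
    moreover have "norm (r x) \<le> 2 * cmod (z - w) * C"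
      using bd(2)[OF x] by (simp add: r_def norm_vector_scalar_mult norm_mult mult_left_mono)
    ultimately have "norm (Q x) * norm (r x) \<le> 2 * C * (2 * cmod (z - w) * C)"
      using C by (intro mult_mono) auto
    then have "- (Q x \<bullet> r x) \<le> 4 * C\<^sup>2 * cmod (z - w)"
      using Cauchy_Schwarz_ineq2[of "Q x" "r x"] by (simp add: power2_eq_square algebra_simps)
    moreover have "0 \<le> Im z * (Q x \<bullet> Q x)"
      using \<open>0 \<le> Im z\<close> by simp
    ultimately show "- 2 * (Re (-2 * \<i> * z) * (Q x \<bullet> Q x) + Q x \<bullet> r x) \<le> 8 * C\<^sup>2 * cmod (z - w)"
      by simp
  qed (use \<open>0 \<le> l\<close> in auto)
  moreover have "P 0 \<bullet> P 0 = 0"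
    using \<open>A 0 = A' 0\<close> by (simp add: P_def)
  ultimately have "Q 0 \<bullet> Q 0 \<le> Q l \<bullet> Q l + 8 * C\<^sup>2 * cmod (z - w) * l"
    using inner_ge_zero[of "P l"] by (simp del: inner_ge_zero)
  then show ?thesis
    by (simp add: Q_def power2_norm_eq_inner)
qed

section \<open>Weyl functions\<close>

lemma sum_UNIV_Plus:
  fixes f :: "'a::finite + 'b::finite \<Rightarrow> 'c::comm_monoid_add"
  shows "sum f UNIV = (\<Sum>i\<in>UNIV. f (Inl i)) + (\<Sum>i\<in>UNIV. f (Inr i))"
  by (simp add: UNIV_Plus_UNIV[symmetric] sum.Plus del: UNIV_Plus_UNIV)

lemma mult_if_zero: "(if P then a else 0) * b = (if P then a * b else 0)" for a b :: "'a::mult_zero"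
  by simp

lemma dirac_j_nth:
  "dirac_j $ Inl i $ Inl i' = (if i = i' then 1 else 0)" "dirac_j $ Inl i $ Inr k = 0"
  "dirac_j $ Inr k $ Inl i = 0" "dirac_j $ Inr k $ Inr k' = (if k = k' then - 1 else 0)"
  by (simp_all add: dirac_j_def block_def mat_def)

lemma dirac_V_nth:
  "dirac_V v x $ Inl i $ Inl i' = 0" "dirac_V v x $ Inl i $ Inr k = v x $ i $ k"
  "dirac_V v x $ Inr k $ Inl i = ctranspose (v x) $ k $ i" "dirac_V v x $ Inr k $ Inr k' = 0"
  by (simp_all add: dirac_V_def block_def)

lemma dirac_j_mult_nth:
  fixes X :: "complex^'k^('m1::finite + 'm2::finite)"
  shows "(dirac_j ** X) $ Inl i $ s = X $ Inl i $ s" "(dirac_j ** X) $ Inr k $ s = - X $ Inr k $ s"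
  by (simp_all add: matrix_matrix_mult_def dirac_j_nth sum_UNIV_Plus mult_if_zero cong: if_cong)

definition inl_part :: "'a^('m1::finite + 'm2::finite) \<Rightarrow> 'a^'m1"
  where "inl_part w = (\<chi> i. w $ Inl i)"

definition inr_part :: "'a^('m1::finite + 'm2::finite) \<Rightarrow> 'a^'m2"
  where "inr_part w = (\<chi> i. w $ Inr i)"

lemma dirac_generator_parts:
  fixes w :: "complex^('m1::finite + 'm2::finite)"
  shows "inl_part (cscale \<i> (cscale z dirac_j + dirac_j ** dirac_V v x) *v w)
      = \<i> *s (z *s inl_part w + v x *v inr_part w)"
    and "inr_part (cscale \<i> (cscale z dirac_j + dirac_j ** dirac_V v x) *v w)
      = - \<i> *s (z *s inr_part w + ctranspose (v x) *v inl_part w)"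
  by (simp_all add: vec_eq_iff inl_part_def inr_part_def matrix_vector_mult_def cscale_def map_matrix_def
      dirac_j_mult_nth dirac_j_nth dirac_V_nth sum_UNIV_Plus algebra_simps
      sum.distrib sum_distrib_left mult_if_zero if_distrib[of "\<lambda>x. _ * x"] sum_negf cong: if_cong)

lemma bounded_linear_inl_part: "bounded_linear (inl_part :: 'a::euclidean_space^('m1::finite + 'm2::finite) \<Rightarrow> _)"
  by (auto simp: linear_conv_bounded_linear[symmetric] inl_part_def vec_eq_iff intro!: linearI)

lemma bounded_linear_inr_part: "bounded_linear (inr_part :: 'a::euclidean_space^('m1::finite + 'm2::finite) \<Rightarrow> _)"
  by (auto simp: linear_conv_bounded_linear[symmetric] inr_part_def vec_eq_iff intro!: linearI)

lemma inner_parts: "w \<bullet> w = inl_part w \<bullet> inl_part w + inr_part w \<bullet> inr_part w"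
  for w :: "complex^('m1::finite + 'm2::finite)"
  by (simp add: inner_vec_def sum_UNIV_Plus inl_part_def inr_part_def)

text \<open>The factor \<open>exp(-izx)\<close> cancels the diagonal term \<open>iz\<close> of the
  upper block and doubles the \<open>-iz\<close> of the lower one. The constant vector
  \<open>p\<close> selects a combination of the columns.\<close>

lemma scaled_dirac_of_solution:
  fixes v :: "real \<Rightarrow> complex^'m2::finite^'m1::finite"
    and Y :: "real \<Rightarrow> complex^'k^('m1 + 'm2)"
  assumes "dirac_solution v z Y"
  shows "scaled_dirac v z (\<lambda>x. exp (- \<i> * z * of_real x) *s inl_part (Y x *v p))
    (\<lambda>x. exp (- \<i> * z * of_real x) *s inr_part (Y x *v p))"
proof -
  let ?G = "\<lambda>x. cscale \<i> (cscale z dirac_j + dirac_j ** dirac_V v x)"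
  have Y: "ac_deriv Y (\<lambda>x. ?G x ** Y x)"
    using assms by (simp add: dirac_solution_def ac_deriv_def)
  have "ac_deriv (\<lambda>x. Y x *v p) (\<lambda>x. (?G x ** Y x) *v p)"
    by (rule ac_deriv_bounded_linear[OF bounded_linear_matrix_vector_mult_left Y])
  then have y: "ac_deriv (\<lambda>x. Y x *v p) (\<lambda>x. ?G x *v (Y x *v p))"
    by (simp add: matrix_vector_mul_assoc)
  show ?thesis
    unfolding scaled_dirac_def
  proof
    show "ac_deriv (\<lambda>x. exp (- \<i> * z * of_real x) *s inl_part (Y x *v p))
      (\<lambda>x. \<i> *s (v x *v (exp (- \<i> * z * of_real x) *s inr_part (Y x *v p))))"
      by (rule ac_deriv_cong[OF ac_deriv_scalar_exp[OF ac_deriv_bounded_linear[OF bounded_linear_inl_part y]]])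
        (simp add: dirac_generator_parts vector_scalar_commute vec_eq_iff algebra_simps)
    show "ac_deriv (\<lambda>x. exp (- \<i> * z * of_real x) *s inr_part (Y x *v p))
      (\<lambda>x. (-2 * \<i> * z) *s (exp (- \<i> * z * of_real x) *s inr_part (Y x *v p)) -
        \<i> *s (ctranspose (v x) *v (exp (- \<i> * z * of_real x) *s inl_part (Y x *v p))))"
      by (rule ac_deriv_cong[OF ac_deriv_scalar_exp[OF ac_deriv_bounded_linear[OF bounded_linear_inr_part y]]])
        (simp add: dirac_generator_parts vector_scalar_commute vec_eq_iff algebra_simps)
  qed
qed

lemma stack_mult_parts:
  "inl_part (stack (mat 1) F *v h) = h" "inr_part (stack (mat 1) F *v h) = F *v h"
  for F :: "complex^'m1^'m2"
  by (simp_all add: inl_part_def inr_part_def stack_def matrix_vector_mult_def vec_eq_iff mat_def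
      mult_if_zero cong: if_cong)

text \<open>The squared norm is the quadratic form at \<open>h\<close> of the integrable matrix,
  hence its image under a bounded linear functional.\<close>

lemma weyl_solution_integrable:
  fixes Y :: "real \<Rightarrow> complex^'n^'m" and S :: "complex^'k^'n"
  assumes "(\<lambda>x. ctranspose S ** ctranspose (Y x) ** Y x ** S) absolutely_integrable_on {0..}"
  shows "(\<lambda>x. (Y x *v (S *v h)) \<bullet> (Y x *v (S *v h))) integrable_on {0..}"
proof -
  let ?T = "\<lambda>M :: complex^'k^'k. h \<bullet> (M *v h)"
  have "(Y x *v (S *v h)) \<bullet> (Y x *v (S *v h)) = ?T (ctranspose S ** ctranspose (Y x) ** Y x ** S)" for x
    using inner_matrix_vector_adjoint[of h "ctranspose (Y x ** S) ** (Y x ** S)" h]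
      inner_matrix_vector_adjoint[of "(Y x ** S) *v h" "Y x ** S" h]
    by (simp add: matrix_mul_assoc ctranspose_mult matrix_vector_mul_assoc inner_commute)
  moreover have "bounded_linear ?T"
    using bounded_linear_compose[OF bounded_linear_inner_right[of h] bounded_linear_matrix_vector_mult_left[of h]]
    .
  then have "(?T \<circ> (\<lambda>x. ctranspose S ** ctranspose (Y x) ** Y x ** S)) integrable_on {0..}"
    using assms by (intro integrable_linear) (auto simp: absolutely_integrable_on_def)
  ultimately show ?thesis
    by (simp add: o_def)
qed

section \<open>Uniform continuity in the upper half-plane and extension to the boundary\<close>

lemma weyl_function_uniformly_continuous:
  fixes v :: "real \<Rightarrow> complex^'m2::finite^'m1::finite" and \<phi> :: "complex \<Rightarrow> complex^'m1^'m2"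
  assumes k: "(\<lambda>x. entry_sum (v x)) integrable_on {0..}" and "is_weyl_function v \<phi>"
  shows "uniformly_continuous_on {z. 0 < Im z} \<phi>"
proof -
  obtain u where u0: "\<And>z. u 0 z = mat 1" and sol: "\<And>z. dirac_solution v z (\<lambda>x. u x z)"
    and int: "\<And>z. 0 < Im z \<Longrightarrow> (\<lambda>x. ctranspose (stack (mat 1) (\<phi> z)) ** ctranspose (u x z) ** u x z
        ** stack (mat 1) (\<phi> z)) absolutely_integrable_on {0..}"
    using assms(2) unfolding is_weyl_function_def fundamental_solution_def by blast
  define y where "y z h x = u x z *v (stack (mat 1) (\<phi> z) *v h)" for z h x
  define A where "A z h x = exp (- \<i> * z * of_real x) *s inl_part (y z h x)" for z h x
  define B where "B z h x = exp (- \<i> * z * of_real x) *s inr_part (y z h x)" for z h x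
  have S: "scaled_dirac v z (A z h) (B z h)" for z h
    unfolding A_def B_def y_def by (rule scaled_dirac_of_solution[OF sol])
  have A0: "A z h 0 = h" and B0: "B z h 0 = \<phi> z *v h" for z h
    by (simp_all add: A_def B_def y_def u0 stack_mult_parts)
  have contr: "norm (B z h x) \<le> norm (A z h x)" if "0 < Im z" "0 \<le> x" for z h x
  proof (rule scaled_dirac_contractive[OF S that(1) _ that(2)])
    \<comment> \<open>The squared modulus of \<open>exp(-izx)\<close> is
      \<open>exp (2 * Im z * x)\<close>, which the weight cancels.\<close>
    have "exp (-2 * Im z * x) * (A z h x \<bullet> A z h x + B z h x \<bullet> B z h x) = y z h x \<bullet> y z h x" for x
    proof -
      have 1: "exp (-2 * Im z * x) * (cmod (exp (- \<i> * z * of_real x)))\<^sup>2 = 1"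
        by (simp add: power2_eq_square exp_add[symmetric])
      have "A z h x \<bullet> A z h x + B z h x \<bullet> B z h x
        = (cmod (exp (- \<i> * z * of_real x)))\<^sup>2 * (y z h x \<bullet> y z h x)"
        unfolding A_def B_def inner_scalar_mult_both inner_parts[of "y z h x"] by (simp only: distrib_left)
      then show ?thesis
        by (simp only: mult.assoc[symmetric] 1 mult_1)
    qed
    then show "(\<lambda>x. exp (-2 * Im z * x) * (A z h x \<bullet> A z h x + B z h x \<bullet> B z h x)) integrable_on {0..}"
      using weyl_solution_integrable[OF int[OF that(1)], of h] by (simp add: y_def)
  qed
  \<comment> \<open>Counts the half units of mass of \<open>v\<close> for the Gronwall bound; the
    resulting \<open>C\<close> is the same for all \<open>z\<close> and all unit vectors
    \<open>h\<close>.\<close>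
  obtain n where n: "2 * integral {0..} (\<lambda>x. entry_sum (v x)) \<le> real n"
    using real_arch_simple by blast
  define C :: real where "C = 2 ^ Suc n"
  have C: "C > 0" "C \<ge> 1"
    unfolding C_def by (simp, rule one_le_power) simp
  have bdA: "norm (A z h x) \<le> C" if "0 < Im z" "0 \<le> x" "norm h = 1" for z h x
  proof -
    have "norm (A z h x) \<le> 2 ^ Suc n * norm (A z h 0)"
      using that n by (intro scaled_dirac_bounded[OF S _ k] contr) auto
    then show ?thesis
      using that by (simp add: A0 C_def)
  qed
  have bdB: "norm (B z h x) \<le> C" if "0 < Im z" "0 \<le> x" "norm h = 1" for z h x
    using bdA[OF that] contr[OF that(1,2), of h] by linarith
  show ?thesis
    unfolding uniformly_continuous_on_def
  proof (intro allI impI)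
    fix e :: real assume "e > 0"
    define c where "c = real CARD('m2) * real CARD('m1)"
    have c: "c > 0"
      by (simp add: c_def)
    \<comment> \<open>Target for a single column: \<open>norm_matrix_le\<close> costs the factor
      \<open>c\<close>, and the 2 leaves room for a strict inequality.\<close>
    define e' where "e' = e / (2 * c)"
    have e': "e' > 0"
      using c \<open>e > 0\<close> by (simp add: e'_def)
    \<comment> \<open>The cut-off is fixed before \<open>z\<close> and \<open>w\<close>. With
      \<open>C \<ge> 1\<close> the tail estimate gives at most \<open>e' / 4\<close> for each
      solution at \<open>l\<close>.\<close>
    obtain l where l: "0 \<le> l"
      "\<bar>integral {0..} (\<lambda>x. entry_sum (v x)) - integral {0..l} (\<lambda>x. entry_sum (v x))\<bar> < e' / (4 * C\<^sup>2)"
      using integral_tail_small[OF k, of "e' / (4 * C\<^sup>2)"] C e' by auto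
    \<comment> \<open>Makes \<open>8 * C\<^sup>2 * d * (l + 1)\<close> equal to half of
      \<open>e'\<^sup>2\<close>; \<open>l + 1\<close> instead of \<open>l\<close> avoids a division
      by 0.\<close>
    define d where "d = e'\<^sup>2 / (16 * C\<^sup>2 * (l + 1))"
    have d: "d > 0" "16 * C\<^sup>2 * (l + 1) * d = e'\<^sup>2"
      using e' C l(1) by (simp_all add: d_def)
    have col: "norm ((\<phi> z - \<phi> w) *v axis j 1) \<le> e'"
      if z: "0 < Im z" and w: "0 < Im w" and zw: "cmod (z - w) < d" for z w j
    proof -
      have tail: "norm (B z (axis j 1) l) \<le> e' / 4" if z: "0 < Im z" for z
      proof -
        have "norm (B z (axis j 1) l) \<le> C *
          (integral {0..} (\<lambda>x. entry_sum (v x)) - integral {0..l} (\<lambda>x. entry_sum (v x)))"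
          by (rule scaled_dirac_tail[OF S z bdA bdB k l(1)]) (use z in auto)
        also have "\<dots> \<le> C * (e' / (4 * C\<^sup>2))"
          using l(2) C by (intro mult_left_mono) auto
        also have "\<dots> = e' / 4 / C"
          using C by (simp add: power2_eq_square)
        also have "\<dots> \<le> e' / 4 / 1"
          using e' by (intro divide_left_mono) (use C in auto)
        finally show ?thesis
          by simp
      qed
      have "(norm (B z (axis j 1) 0 - B w (axis j 1) 0))\<^sup>2
        \<le> (norm (B z (axis j 1) l - B w (axis j 1) l))\<^sup>2 + 8 * C\<^sup>2 * cmod (z - w) * l"
        by (rule scaled_dirac_compare[OF S S _ bdB bdB]) (use z w l(1) in \<open>auto simp: A0\<close>)
      also have "\<dots> \<le> (e' / 2)\<^sup>2 + e'\<^sup>2 / 2"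
      proof (intro add_mono power_mono norm_ge_zero)
        show "norm (B z (axis j 1) l - B w (axis j 1) l) \<le> e' / 2"
          using norm_triangle_ineq4[of "B z (axis j 1) l" "B w (axis j 1) l"] tail[OF z] tail[OF w] by linarith
        have "8 * C\<^sup>2 * cmod (z - w) * l \<le> 8 * C\<^sup>2 * d * (l + 1)"
          using zw l(1) d(1) by (intro mult_mono mult_nonneg_nonneg) auto
        also have "\<dots> = e'\<^sup>2 / 2"
          unfolding d(2)[symmetric] by simp
        finally show "8 * C\<^sup>2 * cmod (z - w) * l \<le> e'\<^sup>2 / 2" .
      qed
      also have "\<dots> \<le> e'\<^sup>2"
        by (simp add: power_divide)
      finally show ?thesis
        using e' by (simp add: B0 matrix_vector_mult_diff_rdistrib power2_le_iff_abs_le)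
    qed
    show "\<exists>d>0. \<forall>z\<in>{z. 0 < Im z}. \<forall>w\<in>{z. 0 < Im z}. dist w z < d \<longrightarrow> dist (\<phi> w) (\<phi> z) < e"
    proof (intro exI[of _ d] conjI ballI impI d(1))
      fix z w assume *: "z \<in> {z. 0 < Im z}" "w \<in> {z. 0 < Im z}" "dist w z < d"
      then have "norm (\<phi> w - \<phi> z) \<le> c * e'"
        unfolding c_def by (intro norm_matrix_le col) (auto simp: dist_norm)
      also have "\<dots> < e"
        using c \<open>e > 0\<close> by (simp add: e'_def)
      finally show "dist (\<phi> w) (\<phi> z) < e"
        by (simp add: dist_norm)
    qed
  qed
qed

theorem corollary3p5:
  fixes v :: "real \<Rightarrow> complex^'m2::finite^'m1::finite"
    and \<phi> :: "complex \<Rightarrow> complex^'m1^'m2"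
  assumes "\<And>r s. (\<lambda>x. dirac_V v x $ r $ s) absolutely_integrable_on {0..}"
    and "is_weyl_function v \<phi>"
  shows "\<exists>\<Phi>. continuous_on {z. 0 \<le> Im z} \<Phi> \<and> (\<forall>z. 0 < Im z \<longrightarrow> \<Phi> z = \<phi> z)"
proof -
  \<comment> \<open>The upper right block of \<open>V\<close> is \<open>v\<close> itself.\<close>
  have "(\<lambda>x. cmod (v x $ i $ k)) integrable_on {0..}" for i k
    using assms(1)[of "Inl i" "Inr k"] by (simp add: dirac_V_def block_def absolutely_integrable_on_def)
  then have "(\<lambda>x. entry_sum (v x)) integrable_on {0..}"
    unfolding entry_sum_def by (intro integrable_sum) auto
  then have "uniformly_continuous_on {z. 0 < Im z} \<phi>"
    using assms(2) by (rule weyl_function_uniformly_continuous)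
  then obtain \<Phi> where "uniformly_continuous_on (closure {z. 0 < Im z}) \<Phi>"
    "\<And>z. z \<in> {z. 0 < Im z} \<Longrightarrow> \<phi> z = \<Phi> z"
    by (rule uniformly_continuous_on_extension_on_closure) (rule that)
  \<comment> \<open>The imaginary part is the inner product with \<open>\<i>\<close>, so this is the
    closure of an open half-space.\<close>
  moreover have "closure {z. 0 < Im z} = {z. 0 \<le> Im z}"
    using closure_halfspace_gt[of \<i> 0] by simp
  ultimately show ?thesis
    by (metis mem_Collect_eq uniformly_continuous_imp_continuous)
qed

end
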